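(* (i) The functions $e_{1,a}$, $a\in\mathbb{Q}/\mathbb{Z}$, generate the rational group ring $\mathbb{Q}[\mathbb{Q}/\mathbb{Z}]$ (viewed as the $\mathbb{Q}$-algebra of functions spanned by the $e(r)$, $r\in\mathbb{Q}/\mathbb{Z}$). (ii) The rational algebra $\mathcal{A}_{\mathbb{Q}}$ is the ($\mathbb{Q}$-)subalgebra of $A=C^*(G)$ generated by the $e_{1,a}$, $a\in\mathbb{Q}/\mathbb{Z}$, and the $\mu_n$, $\mu_n^*$, $n\in\mathbb{N}^\times$.
   Context: Let $R=\prod_p\mathbb{Z}_p$ (all primes $p$), identified with $\mathrm{Hom}(\mathbb{Q}/\mathbb{Z},\mathbb{Q}/\mathbb{Z})$ as a compact ring. For $r\in\mathbb{Q}/\mathbb{Z}$ let $e(r)\in C(R)$, $e(r)(\rho)=\exp(2\pi i\rho(r))$; the $e(r)$ span over $\mathbb{Q}$ a copy of $\mathbb{Q}[\mathbb{Q}/\mathbb{Z}]$ in $C(R)$. $G$ is the locally compact étale groupoid of pairs $(r,\rho)$, $r\in\mathbb{Q}^*_+$, $\rho\in R$, $r\rho\in R$, with $(r_1,\rho_1)\circ(r_2,\rho_2)=(r_1r_2,\rho_2)$ if $r_2\rho_2=\rho_1$. Convolution and adjoint on $C^*(G)$ are $(f_1*f_2)(r,\rho)=\sum_sf_1(rs^{-1},s\rho)f_2(s,\rho)$, $f^*(r,\rho)=\overline{f(r^{-1},r\rho)}$. $C(R)\subset C^*(G)$ as functions supported on $r=1$. For $n\in\mathbb{N}^\times$ (positive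 integers), $\mu_n(r,\rho)=1$ if $r=n$ and $0$ otherwise. The rational algebra $\mathcal{A}_{\mathbb{Q}}$ (the Hecke algebra over $\mathbb{Q}$ of the pair of "$ax+b$" groups $P^+_{\mathbb{Z}}\subset P^+_{\mathbb{Q}}$, realized in $C^*(G)$) is the $\mathbb{Q}$-subalgebra of $C^*(G)$ generated by the $e(r)$, $r\in\mathbb{Q}/\mathbb{Z}$, the $\mu_n$ and the $\mu_n^*$, $n\in\mathbb{N}^\times$; it is presented by $\mu_n^*\mu_n=1$, $\mu_k\mu_n=\mu_{kn}$, $e(0)=1$, $e(r)^*=e(-r)$, $e(r)e(s)=e(r+s)$, $\mu_ne(r)\mu_n^*=\frac1n\sum_{ns=r}e(s)$. A $\mathbb{Q}$-lattice in $\mathbb{R}$ is a pair $(\Lambda,\phi)$ with $\Lambda\subset\mathbb{R}$ a lattice and $\phi:\mathbb{Q}/\mathbb{Z}\to\mathbb{Q}\Lambda/\Lambda$ a homomorphism; each is uniquely $(\lambda\mathbb{Z},\lambda\rho)$ with $\lambda>0$, $\rho\in R$, so functions of $\mathbb{Q}$-lattices in $\mathbb{R}$ invariant under scaling by $\mathbb{R}^*_+$ are functions of $\rho\in R$. Let $c(\Lambda)$ be the multiple of the covolume of $\Lambda$ normalized by $2\pi i\,c(\mathbb{Z})=1$, so $c(\lambda\mathbb{Z})=\lambda/(2\pi i)$. For $a\in\mathbb{Q}/\mathbb{Z}$ define the scale-invariant function $$e_{1,a}(\Lambda,\phi)=c(\Lambda)\sum_{y\in\Lambda+\phi(a)}y^{-1}\quad\text{if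 }\phi(a)\ne0,\qquad e_{1,a}(\Lambda,\phi)=0\quad\text{if }\phi(a)=0,$$ with Eisenstein summation ($\lim_{N\to\infty}\sum_{-N}^{N}$). "Generate" is in the sense of unital algebras over $\mathbb{Q}$. *)

theory Defs
  imports "HOL-Analysis.Analysis"
begin

section \<open>The group \<open>\<rat>/\<int>\<close>\<close>

quotient_type QZ = rat / "\<lambda>x y :: rat. x - y \<in> \<int>" morphisms rep_QZ qz
proof (rule equivpI)
  show "reflp (\<lambda>x y :: rat. x - y \<in> \<int>)" by (rule reflpI) simp
  show "symp (\<lambda>x y :: rat. x - y \<in> \<int>)"
    by (rule sympI) (metis Ints_minus minus_diff_eq)
  show "transp (\<lambda>x y :: rat. x - y \<in> \<int>)"
    by (rule transpI) (metis Ints_add diff_add_cancel add_diff_eq)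
qed

instantiation QZ :: ab_group_add
begin

lift_definition zero_QZ :: QZ is 0 .

lift_definition plus_QZ :: "QZ \<Rightarrow> QZ \<Rightarrow> QZ" is "(+)"
  by (metis Ints_add add_diff_add)

lift_definition minus_QZ :: "QZ \<Rightarrow> QZ \<Rightarrow> QZ" is "(-)"
proof -
  fix a b c d :: rat
  assume "a - b \<in> \<int>" "c - d \<in> \<int>"
  then have "(a - b) - (c - d) \<in> \<int>" by (rule Ints_diff)
  then show "a - c - (b - d) \<in> \<int>" by (simp add: algebra_simps)
qed

lift_definition uminus_QZ :: "QZ \<Rightarrow> QZ" is uminus
  by (metis Ints_minus minus_diff_eq minus_diff_minus)

instance
  by standard (transfer; simp add: algebra_simps)+

end

instantiation QZ :: discrete_topology
begin

definition open_QZ :: "QZ set \<Rightarrow> bool" where "open_QZ U \<longleftrightarrow> True"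

instance by standard (simp_all add: open_QZ_def)

end


section \<open>The compact ring \<open>R = Hom(\<rat>/\<int>, \<rat>/\<int>)\<close>\<close>

typedef Zhat = "{f :: QZ \<Rightarrow> QZ. \<forall>x y. f (x + y) = f x + f y}"
  morphisms app Zhat
  by (rule exI [of _ "\<lambda>x. x"]) simp

setup_lifting type_definition_Zhat

lemma app_add: "app \<rho> (x + y) = app \<rho> x + app \<rho> y"
  using app [of \<rho>] by simp

lemma app_qz_scale:
  assumes "app \<rho> (qz t) = qz s"
  shows "app \<rho> (qz (of_int k * t)) = qz (of_int k * s)"
proof (induction k rule: int_induct [where k = 0])
  case base
  have "app \<rho> 0 + app \<rho> 0 = app \<rho> 0 + 0" by (simp flip: app_add)
  then have "app \<rho> 0 = 0" by (rule add_left_imp_eq)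
  then show ?case by (simp flip: zero_QZ.abs_eq)
next
  case (step1 i)
  have *: "qz (of_int (i + 1) * u) = qz (of_int i * u) + qz u" for u
    by (simp add: plus_QZ.abs_eq algebra_simps)
  show ?case unfolding * app_add step1 assms ..
next
  case (step2 i)
  have *: "qz (of_int (i - 1) * u) + qz u = qz (of_int i * u)" for u
    by (simp add: plus_QZ.abs_eq algebra_simps)
  have "app \<rho> (qz (of_int (i - 1) * t)) + qz s = qz (of_int (i - 1) * s) + qz s"
    unfolding * using step2 app_add * assms by metis
  then show ?case by (rule add_right_imp_eq)
qed

lemma qz_surj: "\<exists>q. x = qz q"
  by (induct x rule: QZ.abs_induct) blast

lemma qz_eq_iff: "qz x = qz y \<longleftrightarrow> x - y \<in> \<int>"
  by (rule QZ.abs_eq_iff)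

lemma app_cyclic:
  assumes n: "n > 0"
  obtains k :: int where "\<And>m :: int. app \<rho> (qz (of_int m / of_int n)) = qz (of_int (m * k) / of_int n)"
proof -
  obtain s where s: "app \<rho> (qz (1 / of_int n)) = qz s"
    using qz_surj by blast
  have "qz (of_int n * s) = app \<rho> (qz 1)"
    using app_qz_scale [OF s, of n] n by simp
  also have "qz 1 = qz (of_int 0 * 1)" by (simp add: qz_eq_iff)
  also have "app \<rho> \<dots> = qz 0"
  proof -
    obtain w where "app \<rho> (qz 1) = qz w" using qz_surj by blast
    from app_qz_scale [OF this, of 0] show ?thesis by simp
  qed
  finally have "of_int n * s \<in> \<int>" by (simp add: qz_eq_iff)
  then obtain k where "of_int n * s = of_int k" by (auto elim: Ints_cases)
  then have "s = of_int k / of_int n" using n by (simp add: field_simps)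
  then have "app \<rho> (qz (of_int m / of_int n)) = qz (of_int (m * k) / of_int n)" for m
    using app_qz_scale [OF s, of m] by simp
  then show ?thesis using that by blast
qed

lemma app_commute: "app \<rho> (app \<sigma> x) = app \<sigma> (app \<rho> x)"
proof -
  obtain q where q: "x = qz q" using qz_surj by blast
  obtain m n where mn: "q = of_int m / of_int n" "n > 0"
    by (metis Fract_of_int_quotient Rat_cases)
  obtain k where k: "\<And>m. app \<rho> (qz (of_int m / of_int n)) = qz (of_int (m * k) / of_int n)"
    using app_cyclic [OF mn(2)] by blast
  obtain l where l: "\<And>m. app \<sigma> (qz (of_int m / of_int n)) = qz (of_int (m * l) / of_int n)"
    using app_cyclic [OF mn(2)] by blast
  show ?thesis unfolding q mn(1) k l by (simp add: mult_ac)
qed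

text \<open>Addition is pointwise and multiplication is composition.\<close>

instantiation Zhat :: comm_ring_1
begin

lift_definition zero_Zhat :: Zhat is "\<lambda>x. 0" by simp

lift_definition one_Zhat :: Zhat is "\<lambda>x. x" by simp

lift_definition plus_Zhat :: "Zhat \<Rightarrow> Zhat \<Rightarrow> Zhat" is "\<lambda>f g x. f x + g x"
  by (simp add: algebra_simps)

lift_definition minus_Zhat :: "Zhat \<Rightarrow> Zhat \<Rightarrow> Zhat" is "\<lambda>f g x. f x - g x"
  by (simp add: algebra_simps)

lift_definition uminus_Zhat :: "Zhat \<Rightarrow> Zhat" is "\<lambda>f x. - f x"
  by (simp add: algebra_simps)

lift_definition times_Zhat :: "Zhat \<Rightarrow> Zhat \<Rightarrow> Zhat" is "\<lambda>f g x. f (g x)"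
  by simp

instance
proof
  fix a b c :: Zhat
  show "a * b * c = a * (b * c)" by transfer simp
  show "a * b = b * a"
    by (simp add: app_inject [symmetric] times_Zhat.rep_eq fun_eq_iff app_commute)
  show "1 * a = a" by transfer simp
  show "a + b + c = a + (b + c)" by transfer (simp add: algebra_simps)
  show "a + b = b + a" by transfer (simp add: algebra_simps)
  show "0 + a = a" by transfer simp
  show "- a + a = 0" by transfer simp
  show "a - b = a + - b" by transfer simp
  show "(a + b) * c = a * c + b * c" by transfer simp
  show "(0 :: Zhat) \<noteq> 1"
  proof
    assume "(0 :: Zhat) = 1"
    then have "app 0 (qz (1/2)) = app 1 (qz (1/2))" by simp
    then have "qz 0 = qz (1/2)"
      by (simp add: zero_Zhat.rep_eq one_Zhat.rep_eq zero_QZ.abs_eq)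
    then have "(1/2 :: rat) \<in> \<int>" by (simp add: qz_eq_iff)
    then obtain k :: int where "(1/2 :: rat) = of_int k" by (auto elim: Ints_cases)
    then have "of_int (2 * k) = (of_int 1 :: rat)" by simp
    then have "2 * k = 1" by (simp only: of_int_eq_iff)
    then show False by presburger
  qed
qed

end

text \<open>The topology of pointwise convergence, i.e. the one induced from the product topology on
  \<open>QZ \<Rightarrow> QZ\<close> with \<open>QZ\<close> discrete; it is the profinite topology of \<open>\<Prod>\<^sub>p \<int>\<^sub>p\<close>.\<close>

instantiation Zhat :: topological_space
begin

definition open_Zhat :: "Zhat set \<Rightarrow> bool" where
  "open_Zhat U \<longleftrightarrow> (\<exists>V. open V \<and> U = app -` V)"

instance
proof
  show "open (UNIV :: Zhat set)" unfolding open_Zhat_def by (rule exI [of _ UNIV]) simp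
next
  fix S T :: "Zhat set" assume "open S" "open T"
  then show "open (S \<inter> T)" unfolding open_Zhat_def by (metis open_Int vimage_Int)
next
  fix K :: "Zhat set set" assume "\<forall>S\<in>K. open S"
  then obtain V where V: "\<And>S. S \<in> K \<Longrightarrow> open (V S) \<and> S = app -` V S"
    unfolding open_Zhat_def by metis
  then have "open (\<Union>S\<in>K. V S)" and "\<Union>K = app -` (\<Union>S\<in>K. V S)" by blast+
  then show "open (\<Union>K)" unfolding open_Zhat_def by blast
qed

end


section \<open>The functions \<open>e(r)\<close> and the rational group ring\<close>

lift_definition char_QZ :: "QZ \<Rightarrow> complex" is "\<lambda>q. exp (2 * of_real pi * \<i> * of_rat q)"
proof -
  fix x y :: rat
  assume "x - y \<in> \<int>"
  then obtain k where k: "x = y + of_int k" by (metis Ints_cases diff_add_cancel add.commute)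
  show "exp (2 * of_real pi * \<i> * of_rat x) = exp (2 * of_real pi * \<i> * (of_rat y :: complex))"
    by (rule exp_eq [THEN iffD2], rule exI [of _ k])
      (simp add: k of_rat_add algebra_simps)
qed

definition e_fun :: "QZ \<Rightarrow> Zhat \<Rightarrow> complex" where
  "e_fun r \<rho> = char_QZ (app \<rho> r)"

definition rational_group_ring :: "(Zhat \<Rightarrow> complex) set" where
  "rational_group_ring =
     {f. \<exists>(S :: QZ set) (c :: QZ \<Rightarrow> rat). finite S \<and> f = (\<lambda>\<rho>. \<Sum>r\<in>S. of_rat (c r) * e_fun r \<rho>)}"


section \<open>Generated unital \<open>\<rat>\<close>-subalgebras\<close>

text \<open>\<open>A\<close> is the ambient algebra of complex functions on \<open>'x\<close>, with pointwise addition and scalar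
  multiplication, product \<open>mul\<close> and unit \<open>u\<close>.\<close>

definition Q_subalgebra ::
    "('x \<Rightarrow> complex) set \<Rightarrow> (('x \<Rightarrow> complex) \<Rightarrow> ('x \<Rightarrow> complex) \<Rightarrow> 'x \<Rightarrow> complex)
      \<Rightarrow> ('x \<Rightarrow> complex) \<Rightarrow> ('x \<Rightarrow> complex) set \<Rightarrow> bool" where
  "Q_subalgebra A mul u B \<longleftrightarrow>
     B \<subseteq> A \<and> u \<in> B \<and>
     (\<forall>f\<in>B. \<forall>g\<in>B. (\<lambda>x. f x + g x) \<in> B \<and> mul f g \<in> B) \<and>
     (\<forall>q :: rat. \<forall>f\<in>B. (\<lambda>x. of_rat q * f x) \<in> B)"

definition Q_generated ::
    "('x \<Rightarrow> complex) set \<Rightarrow> (('x \<Rightarrow> complex) \<Rightarrow> ('x \<Rightarrow> complex) \<Rightarrow> 'x \<Rightarrow> complex)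
      \<Rightarrow> ('x \<Rightarrow> complex) \<Rightarrow> ('x \<Rightarrow> complex) set \<Rightarrow> ('x \<Rightarrow> complex) set" where
  "Q_generated A mul u S = \<Inter>{B. Q_subalgebra A mul u B \<and> S \<subseteq> B}"

definition C_R :: "(Zhat \<Rightarrow> complex) set" where
  "C_R = {f. continuous_on UNIV f}"

abbreviation Q_generated_C_R :: "(Zhat \<Rightarrow> complex) set \<Rightarrow> (Zhat \<Rightarrow> complex) set" where
  "Q_generated_C_R \<equiv> Q_generated C_R (\<lambda>f g \<rho>. f \<rho> * g \<rho>) (\<lambda>\<rho>. 1)"


section \<open>The groupoid \<open>G\<close> and its \<open>C\<^sup>*\<close>-algebra\<close>

text \<open>\<open>is_rscale r \<rho> \<sigma>\<close> says \<open>r\<rho> = \<sigma>\<close> in \<open>R \<otimes> \<rat>\<close>, with the denominator of \<open>r\<close> cleared. As \<open>R\<close> is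
  torsion-free, \<open>\<sigma>\<close> is unique, so \<open>rscale r \<rho>\<close> is the element \<open>r\<rho>\<close> whenever \<open>r\<rho> \<in> R\<close>.\<close>

definition is_rscale :: "rat \<Rightarrow> Zhat \<Rightarrow> Zhat \<Rightarrow> bool" where
  "is_rscale r \<rho> \<sigma> \<longleftrightarrow>
     of_int (snd (quotient_of r)) * \<sigma> = of_int (fst (quotient_of r)) * \<rho>"

definition rscale :: "rat \<Rightarrow> Zhat \<Rightarrow> Zhat" where
  "rscale r \<rho> = (THE \<sigma>. is_rscale r \<rho> \<sigma>)"

lemma app_of_int_mult: "app (of_int k * \<rho>) (qz q) = app \<rho> (qz (of_int k * q))"
proof -
  have one: "app 1 (qz q) = qz q" by (simp add: one_Zhat.rep_eq)
  have k: "app (of_int k) (qz q) = qz (of_int k * q)"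
  proof (induction k rule: int_induct [where k = 0])
    case base
    then show ?case by (simp add: zero_Zhat.rep_eq zero_QZ.abs_eq)
  next
    case (step1 i)
    then show ?case
      by (simp add: plus_Zhat.rep_eq one_Zhat.rep_eq plus_QZ.abs_eq algebra_simps)
  next
    case (step2 i)
    then show ?case
      by (simp add: minus_Zhat.rep_eq one_Zhat.rep_eq minus_QZ.abs_eq algebra_simps)
  qed
  have "app (of_int k * \<rho>) (qz q) = app (\<rho> * of_int k) (qz q)" by (simp add: mult.commute)
  then show ?thesis by (simp add: times_Zhat.rep_eq k)
qed

lemma of_int_mult_cancel_Zhat:
  fixes \<rho> \<sigma> :: Zhat
  assumes "of_int b * \<sigma> = of_int b * \<rho>" "b \<noteq> 0"
  shows "\<sigma> = \<rho>"
proof -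
  have "app \<sigma> x = app \<rho> x" for x
  proof -
    obtain q where q: "x = qz q" using qz_surj by blast
    have "app (of_int b * \<sigma>) (qz (q / of_int b)) = app (of_int b * \<rho>) (qz (q / of_int b))"
      using assms(1) by simp
    then show ?thesis unfolding app_of_int_mult q using assms(2) by simp
  qed
  then show ?thesis by (simp add: app_inject [symmetric] fun_eq_iff)
qed

lemma rscale_eq:
  assumes "is_rscale r \<rho> \<sigma>"
  shows "rscale r \<rho> = \<sigma>"
  unfolding rscale_def
proof (rule the_equality [where P = "is_rscale r \<rho>", OF assms])
  fix \<tau> assume "is_rscale r \<rho> \<tau>"
  moreover have "snd (quotient_of r) \<noteq> 0"
    using quotient_of_denom_pos' [of r] by simp
  ultimately show "\<tau> = \<sigma>"
    using assms of_int_mult_cancel_Zhat unfolding is_rscale_def by metis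
qed

definition Grpd :: "(rat \<times> Zhat) set" where
  "Grpd = {(r, \<rho>). r > 0 \<and> (\<exists>\<sigma>. is_rscale r \<rho> \<sigma>)}"

definition Grpd_top :: "(rat \<times> Zhat) topology" where
  "Grpd_top = subtopology (prod_topology (discrete_topology {0<..}) euclidean) Grpd"

text \<open>\<open>(r, \<rho>)\<close> is an arrow from \<open>\<rho>\<close> to \<open>r\<rho>\<close>, and \<open>(r\<^sub>1, \<rho>\<^sub>1) \<circ> (r\<^sub>2, \<rho>\<^sub>2) = (r\<^sub>1r\<^sub>2, \<rho>\<^sub>2)\<close> if \<open>r\<^sub>2\<rho>\<^sub>2 = \<rho>\<^sub>1\<close>.
  The arrows with source \<open>\<rho>\<close> are the pairs \<open>(s, \<rho>)\<close> with \<open>s \<in> Grpd_from \<rho>\<close>.\<close>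

definition Grpd_from :: "Zhat \<Rightarrow> rat set" where
  "Grpd_from \<rho> = {s. (s, \<rho>) \<in> Grpd}"

text \<open>Functions on \<open>G\<close> are represented as functions on \<open>rat \<times> Zhat\<close> vanishing off \<open>Grpd\<close>.\<close>

definition Cc_G :: "(rat \<times> Zhat \<Rightarrow> complex) set" where
  "Cc_G = {f. continuous_map Grpd_top euclidean f \<and> (\<exists>K. compactin Grpd_top K \<and> (\<forall>g. g \<notin> K \<longrightarrow> f g = 0))}"

definition conv :: "(rat \<times> Zhat \<Rightarrow> complex) \<Rightarrow> (rat \<times> Zhat \<Rightarrow> complex) \<Rightarrow> rat \<times> Zhat \<Rightarrow> complex" where
  "conv f1 f2 = (\<lambda>(r, \<rho>). if (r, \<rho>) \<in> Grpd
     then \<Sum>\<^sub>\<infinity>s\<in>Grpd_from \<rho>. f1 (r / s, rscale s \<rho>) * f2 (s, \<rho>) else 0)"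

definition adj :: "(rat \<times> Zhat \<Rightarrow> complex) \<Rightarrow> rat \<times> Zhat \<Rightarrow> complex" where
  "adj f = (\<lambda>(r, \<rho>). if (r, \<rho>) \<in> Grpd then cnj (f (1 / r, rscale r \<rho>)) else 0)"

text \<open>The regular representation \<open>\<pi>\<^sub>\<rho>\<close> of \<open>C\<^sub>c(G)\<close> on \<open>\<ell>\<^sup>2(Grpd_from \<rho>)\<close>.\<close>

definition reg_rep :: "Zhat \<Rightarrow> (rat \<times> Zhat \<Rightarrow> complex) \<Rightarrow> (rat \<Rightarrow> complex) \<Rightarrow> rat \<Rightarrow> complex" where
  "reg_rep \<rho> f \<xi> = (\<lambda>r. \<Sum>\<^sub>\<infinity>s\<in>Grpd_from \<rho>. f (r / s, rscale s \<rho>) * \<xi> s)"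

definition l2 :: "'i set \<Rightarrow> ('i \<Rightarrow> complex) set" where
  "l2 I = {\<xi>. (\<lambda>i. (cmod (\<xi> i))\<^sup>2) summable_on I}"

definition l2_norm :: "'i set \<Rightarrow> ('i \<Rightarrow> complex) \<Rightarrow> real" where
  "l2_norm I \<xi> = sqrt (\<Sum>\<^sub>\<infinity>i\<in>I. (cmod (\<xi> i))\<^sup>2)"

definition reg_norm :: "Zhat \<Rightarrow> (rat \<times> Zhat \<Rightarrow> complex) \<Rightarrow> real" where
  "reg_norm \<rho> f = Inf {C. 0 \<le> C \<and> (\<forall>\<xi>\<in>l2 (Grpd_from \<rho>).
     reg_rep \<rho> f \<xi> \<in> l2 (Grpd_from \<rho>) \<and>
     l2_norm (Grpd_from \<rho>) (reg_rep \<rho> f \<xi>) \<le> C * l2_norm (Grpd_from \<rho>) \<xi>)}"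

definition Cstar_norm :: "(rat \<times> Zhat \<Rightarrow> complex) \<Rightarrow> real" where
  "Cstar_norm f = (SUP \<rho>. reg_norm \<rho> f)"

text \<open>\<open>C\<^sup>*(G)\<close> is the completion of \<open>C\<^sub>c(G)\<close> in the norm \<open>sup\<^sub>\<rho> \<parallel>\<pi>\<^sub>\<rho>(f)\<parallel>\<close>; since \<open>G\<close> is amenable, this is
  also the maximal norm. As \<open>G\<close> is etale, the norm dominates the supremum norm and an element of the
  completion is determined by its coefficients \<open>(r, \<rho>) \<mapsto> \<langle>\<delta>\<^sub>r, \<pi>\<^sub>\<rho>(a) \<delta>\<^sub>1\<rangle>\<close>; the completion is
  therefore realised by the functions on \<open>G\<close> that are pointwise limits of Cauchy sequences of
  \<open>C\<^sub>c(G)\<close>. In this realisation the product is \<open>conv\<close>, the defining series being absolutely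
  convergent, and the adjoint is \<open>adj\<close>.\<close>

definition Cstar_G :: "(rat \<times> Zhat \<Rightarrow> complex) set" where
  "Cstar_G = {f. \<exists>F :: nat \<Rightarrow> rat \<times> Zhat \<Rightarrow> complex. (\<forall>n. F n \<in> Cc_G) \<and>
     (\<forall>\<epsilon>>0. \<exists>N. \<forall>m\<ge>N. \<forall>n\<ge>N. Cstar_norm (\<lambda>g. F m g - F n g) < \<epsilon>) \<and>
     (\<forall>g. (\<lambda>n. F n g) \<longlonglongrightarrow> f g)}"

text \<open>The inclusion \<open>C(R) \<subseteq> C\<^sup>*(G)\<close>; in particular \<open>incl (\<lambda>\<rho>. 1)\<close> is the unit of \<open>C\<^sup>*(G)\<close>.\<close>

definition incl :: "(Zhat \<Rightarrow> complex) \<Rightarrow> rat \<times> Zhat \<Rightarrow> complex" where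
  "incl f = (\<lambda>(r, \<rho>). if r = 1 then f \<rho> else 0)"

definition mu :: "nat \<Rightarrow> rat \<times> Zhat \<Rightarrow> complex" where
  "mu n = (\<lambda>(r, \<rho>). if r = of_nat n then 1 else 0)"

abbreviation Q_generated_Cstar_G :: "(rat \<times> Zhat \<Rightarrow> complex) set \<Rightarrow> (rat \<times> Zhat \<Rightarrow> complex) set" where
  "Q_generated_Cstar_G \<equiv> Q_generated Cstar_G conv (incl (\<lambda>\<rho>. 1))"

definition A_Q :: "(rat \<times> Zhat \<Rightarrow> complex) set" where
  "A_Q = Q_generated_Cstar_G
     (range (\<lambda>r. incl (e_fun r)) \<union> {mu n | n. n \<ge> 1} \<union> {adj (mu n) | n. n \<ge> 1})"


section \<open>\<open>\<rat>\<close>-lattices in \<open>\<real>\<close>\<close>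

definition is_lattice :: "real set \<Rightarrow> bool" where
  "is_lattice \<Lambda> \<longleftrightarrow> 0 \<in> \<Lambda> \<and> (\<forall>x\<in>\<Lambda>. \<forall>y\<in>\<Lambda>. x - y \<in> \<Lambda>) \<and> discrete \<Lambda> \<and> \<Lambda> \<noteq> {0}"

text \<open>Elements of \<open>\<rat>\<Lambda>/\<Lambda>\<close> are cosets, i.e. sets of reals.\<close>

definition coset :: "real set \<Rightarrow> real \<Rightarrow> real set" where
  "coset \<Lambda> t = (\<lambda>x. t + x) ` \<Lambda>"

definition is_Q_lattice :: "real set \<times> (QZ \<Rightarrow> real set) \<Rightarrow> bool" where
  "is_Q_lattice = (\<lambda>(\<Lambda>, \<phi>). is_lattice \<Lambda> \<and>
     (\<forall>a. \<exists>q :: rat. \<exists>x\<in>\<Lambda>. \<phi> a = coset \<Lambda> (of_rat q * x)) \<and>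
     (\<forall>a b. \<phi> (a + b) = {s + t | s t. s \<in> \<phi> a \<and> t \<in> \<phi> b}))"

text \<open>The \<open>\<rat>\<close>-lattice \<open>(\<lambda>\<int>, \<lambda>\<rho>)\<close>.\<close>

definition Q_lattice :: "real \<Rightarrow> Zhat \<Rightarrow> real set \<times> (QZ \<Rightarrow> real set)" where
  "Q_lattice l \<rho> = (range (\<lambda>k :: int. l * of_int k), \<lambda>a. {l * of_rat q | q. qz q = app \<rho> a})"

definition covolume :: "real set \<Rightarrow> real" where
  "covolume \<Lambda> = (THE l. l > 0 \<and> \<Lambda> = range (\<lambda>k :: int. l * of_int k))"

definition c_lat :: "real set \<Rightarrow> complex" where
  "c_lat \<Lambda> = of_real (covolume \<Lambda>) / (2 * of_real pi * \<i>)"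

text \<open>Eisenstein summation of \<open>y\<^sup>-\<^sup>1\<close> over a coset \<open>C = y + \<Lambda>\<close>; the limit of the partial sums over
  \<open>y + kl\<close>, \<open>-N \<le> k \<le> N\<close>, with \<open>l\<close> the positive generator of \<open>\<Lambda>\<close>, does not depend on the choice of
  \<open>y \<in> C\<close>.\<close>

definition eisenstein_sum :: "real set \<Rightarrow> real set \<Rightarrow> real" where
  "eisenstein_sum \<Lambda> C = (THE S. \<forall>y\<in>C.
     (\<lambda>N :: nat. \<Sum>k\<in>{- int N..int N}. inverse (y + of_int k * covolume \<Lambda>)) \<longlonglongrightarrow> S)"

definition e1_lat :: "QZ \<Rightarrow> real set \<times> (QZ \<Rightarrow> real set) \<Rightarrow> complex" where
  "e1_lat a = (\<lambda>(\<Lambda>, \<phi>). if \<phi> a = \<Lambda> then 0 else c_lat \<Lambda> * of_real (eisenstein_sum \<Lambda> (\<phi> a)))"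

lemma covolume_eq:
  assumes "l > 0"
  shows "covolume (range (\<lambda>k :: int. l * of_int k)) = l"
  unfolding covolume_def
proof (rule the_equality)
  show "l > 0 \<and> range (\<lambda>k :: int. l * of_int k) = range (\<lambda>k :: int. l * of_int k)"
    using assms by simp
next
  fix m :: real
  assume m: "m > 0 \<and> range (\<lambda>k :: int. l * of_int k) = range (\<lambda>k :: int. m * of_int k)"
  have "l * of_int 1 \<in> range (\<lambda>k :: int. m * of_int k)" using m by blast
  then obtain i :: int where i: "l = m * of_int i" by auto
  have "m * of_int 1 \<in> range (\<lambda>k :: int. l * of_int k)" using m by blast
  then obtain j :: int where j: "m = l * of_int j" by auto
  have "i > 0" "j > 0" using i j m assms zero_less_mult_pos
    by (metis of_int_0_less_iff)+
  have "l * of_int (j * i) = l * of_int 1" using i j by simp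
  then have "j * i = 1" using assms by (simp only: mult_cancel_left of_int_eq_iff) simp
  then have "j = 1" using \<open>j > 0\<close> pos_zmult_eq_1_iff by blast
  then show "m = l" using j by simp
qed

lemma is_Q_lattice_Q_lattice:
  assumes l: "l > 0"
  shows "is_Q_lattice (Q_lattice l \<rho>)"
proof -
  let ?L = "range (\<lambda>k :: int. l * of_int k)"
  have disc: "discrete ?L"
  proof (rule uniform_discrete_imp_discrete)
    show "uniform_discrete ?L"
      unfolding uniform_discrete_def
    proof (intro exI [of _ l] conjI ballI impI)
      fix x y assume "x \<in> ?L" "y \<in> ?L" and d: "dist x y < l"
      then obtain i j :: int where ij: "x = l * of_int i" "y = l * of_int j" by auto
      have "dist x y = l * of_int \<bar>i - j\<bar>"
        using l by (simp add: ij dist_real_def abs_mult flip: right_diff_distrib)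
      with d l have "\<bar>i - j\<bar> < 1" by (simp add: mult_less_cancel_left1)
      then show "x = y" by (simp add: ij)
    qed (use l in auto)
  qed
  have lat: "is_lattice ?L"
    unfolding is_lattice_def
  proof (intro conjI ballI disc)
    show "0 \<in> ?L" by (rule range_eqI [of _ _ 0]) simp
    show "x - y \<in> ?L" if xy: "x \<in> ?L" "y \<in> ?L" for x y
    proof -
      from xy obtain i j :: int where "x = l * of_int i" "y = l * of_int j" by auto
      then have "x - y = l * of_int (i - j)" by (simp add: algebra_simps)
      then show ?thesis by blast
    qed
    have "l * of_int 1 \<in> ?L" by blast
    moreover have "l * of_int 1 \<notin> {0}" using l by simp
    ultimately show "?L \<noteq> {0}" by metis
  qed
  have co: "{l * of_rat q' | q'. qz q' = qz q} = coset ?L (of_rat q * l)" for q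
  proof (intro equalityI subsetI)
    fix x assume "x \<in> {l * of_rat q' | q'. qz q' = qz q}"
    then obtain q' where x: "x = l * of_rat q'" and "q' - q \<in> \<int>" by (auto simp: qz_eq_iff)
    then obtain k where "q' = q + of_int k" by (metis Ints_cases diff_add_cancel add.commute)
    then show "x \<in> coset ?L (of_rat q * l)"
      by (auto simp: x coset_def of_rat_add algebra_simps)
  next
    fix x assume "x \<in> coset ?L (of_rat q * l)"
    then obtain k :: int where "x = of_rat q * l + l * of_int k" by (auto simp: coset_def)
    then have "x = l * of_rat (q + of_int k)" by (simp add: of_rat_add algebra_simps)
    moreover have "qz (q + of_int k) = qz q" by (simp add: qz_eq_iff)
    ultimately show "x \<in> {l * of_rat q' | q'. qz q' = qz q}" by blast
  qed
  have phi: "\<exists>q :: rat. \<exists>x\<in>?L. {l * of_rat q | q. qz q = app \<rho> a} = coset ?L (of_rat q * x)" for a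
  proof -
    obtain q where "app \<rho> a = qz q" using qz_surj by blast
    moreover have "l \<in> ?L" by (rule range_eqI [of _ _ 1]) simp
    ultimately show ?thesis using co by metis
  qed
  have hom: "{l * of_rat q | q. qz q = app \<rho> (a + b)} =
      {s + t | s t. s \<in> {l * of_rat q | q. qz q = app \<rho> a} \<and> t \<in> {l * of_rat q | q. qz q = app \<rho> b}}"
    (is "?A = ?B") for a b
  proof (intro equalityI subsetI)
    fix x assume "x \<in> ?A"
    then obtain q where q: "x = l * of_rat q" "qz q = app \<rho> a + app \<rho> b" by (auto simp: app_add)
    obtain u where u: "app \<rho> a = qz u" using qz_surj by blast
    have "x = l * of_rat u + l * of_rat (q - u)" by (simp add: q of_rat_diff algebra_simps)
    moreover have "qz (q - u) = app \<rho> b"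
      using q(2) u by (simp flip: minus_QZ.abs_eq)
    ultimately show "x \<in> ?B" using u by (metis (mono_tags, lifting) mem_Collect_eq)
  next
    fix x assume "x \<in> ?B"
    then obtain u v where "x = l * of_rat u + l * of_rat v" "qz u = app \<rho> a" "qz v = app \<rho> b"
      by auto
    then have "x = l * of_rat (u + v)" "qz (u + v) = app \<rho> (a + b)"
      by (simp_all add: of_rat_add algebra_simps app_add flip: plus_QZ.abs_eq)
    then show "x \<in> ?A" by blast
  qed
  show ?thesis unfolding is_Q_lattice_def Q_lattice_def using lat phi hom by simp
qed

text \<open>\<open>e1_lat a\<close> is invariant under scaling, hence a function of \<open>\<rho> \<in> R\<close>, read off at the
  \<open>\<rat>\<close>-lattice \<open>(\<int>, \<rho>)\<close>.\<close>

definition e1 :: "QZ \<Rightarrow> Zhat \<Rightarrow> complex" where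
  "e1 a \<rho> = e1_lat a (Q_lattice 1 \<rho>)"

end

theory Submission
  imports Defs
begin

text \<open>Write \<open>z = e(a)\<close>. The cotangent expansion gives \<open>e\<^bsub>1,a\<^esub> = (z + 1) / (2 (z - 1))\<close> where
  \<open>z \<noteq> 1\<close>, and \<open>e\<^bsub>1,a\<^esub> = 0\<close> where \<open>z = 1\<close>. As \<open>z\<close> is a root of unity of bounded order \<open>N\<close>, this is
  the polynomial \<open>1/2 + \<Sum>k<N. (k/N - 1/2) z\<^sup>k\<close> in \<open>z\<close>.
  Conversely \<open>e\<^bsub>1,a\<^esub>\<close> determines \<open>z\<close> up to the confusion of \<open>1\<close> and \<open>-1\<close>, hence determines
  \<open>z\<^sup>2 = e(2a)\<close>: with \<open>u = 2 e\<^bsub>1,a\<^esub> - 1\<close> one has \<open>z\<^sup>2 = ((u + 2) / u)\<^sup>2\<close> everywhere, and for even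
  \<open>N\<close> the equation \<open>(u + 2)\<^sup>N = u\<^sup>N\<close> has constant term \<open>2\<^sup>N\<close>, so \<open>1/u\<close> is a rational polynomial
  in \<open>u\<close>. Since \<open>\<rat>/\<int>\<close> is divisible, all \<open>e(r)\<close> are obtained. The second part follows from the
  first because the inclusion of \<open>C(R)\<close> turns pointwise products into convolutions.\<close>

section \<open>The cotangent series\<close>

text \<open>Logarithmic derivative of the reflection formula: both sides of
  \<open>rGamma z * rGamma (1 - z) = sin (pi * z) / pi\<close> are differentiated. The product
  \<open>s\<close> can be cancelled because \<open>rGamma\<close> vanishes only at nonpositive
  integers.\<close>

lemma Digamma_reflection:
  fixes z :: complex
  assumes "z \<notin> \<int>"
  shows "Digamma (1 - z) - Digamma z = of_real pi * cot (of_real pi * z)"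
proof -
  have "1 - z \<notin> \<int>" using assms by (metis Ints_1 Ints_diff diff_diff_eq2 add_diff_cancel_left')
  then have nz: "z \<notin> \<int>\<^sub>\<le>\<^sub>0" "1 - z \<notin> \<int>\<^sub>\<le>\<^sub>0" using assms nonpos_Ints_Int by blast+
  define s where "s = rGamma z * rGamma (1 - z)"
  have s: "s = sin (of_real pi * z) / of_real pi"
    by (simp add: s_def rGamma_reflection_complex)
  have "s \<noteq> 0" using nz by (simp add: s_def rGamma_eq_zero_iff)
  have "((\<lambda>z. rGamma z * rGamma (1 - z)) has_field_derivative s * (Digamma (1 - z) - Digamma z)) (at z)"
    using nz by (auto intro!: derivative_eq_intros simp: s_def algebra_simps)
  moreover have "((\<lambda>z. sin (of_real pi * z) / of_real pi) has_field_derivative cos (of_real pi * z)) (at z)"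
    by (auto intro!: derivative_eq_intros)
  ultimately have "s * (Digamma (1 - z) - Digamma z) = cos (of_real pi * z)"
    by (simp add: rGamma_reflection_complex DERIV_unique)
  then show ?thesis using \<open>s \<noteq> 0\<close> by (simp add: s cot_def field_simps)
qed

text \<open>In the difference of the limit formulas for \<open>Digamma (1 - z)\<close> and
  \<open>Digamma z\<close> the logarithms cancel, and the two one-sided sums join into a symmetric
  one.\<close>

lemma cot_partial_fractions:
  fixes z :: complex
  assumes "z \<notin> \<int>"
  shows "(\<lambda>N. \<Sum>k\<in>{- int N..int N}. inverse (z + of_int k)) \<longlonglongrightarrow> of_real pi * cot (of_real pi * z)"
proof -
  have ne: "z \<noteq> 0" "1 - z \<noteq> 0" using assms by auto
  have lim0: "(\<lambda>N. inverse (z + of_nat N)) \<longlonglongrightarrow> 0"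
    by (rule filterlim_compose [OF tendsto_inverse_0
        tendsto_add_filterlim_at_infinity [OF tendsto_const tendsto_of_nat]])
  \<comment> \<open>The first sum covers \<open>k = 0..N - 1\<close>, the second, after a sign
    change, \<open>k = -N..-1\<close>. The term \<open>k = N\<close> is left over and tends to 0 by
    \<open>lim0\<close>.\<close>
  have eq: "(\<Sum>n<N. inverse (z + of_nat n)) - (\<Sum>n<N. inverse (1 - z + of_nat n)) + inverse (z + of_nat N)
      = (\<Sum>k\<in>{- int N..int N}. inverse (z + of_int k))" for N
  proof (induction N)
    case (Suc N)
    have "{- int (Suc N)..int (Suc N)} = insert (- int (Suc N)) (insert (int (Suc N)) {- int N..int N})"
      by auto
    then have "(\<Sum>k\<in>{- int (Suc N)..int (Suc N)}. inverse (z + of_int k))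
       = inverse (z - 1 - of_nat N) + (inverse (z + 1 + of_nat N)
          + (\<Sum>k\<in>{- int N..int N}. inverse (z + of_int k)))"
      by (simp add: algebra_simps)
    moreover have "inverse (z - 1 - of_nat N) = - inverse (1 - z + of_nat N)"
      unfolding inverse_minus_eq [symmetric] by simp
    ultimately show ?case by (simp add: algebra_simps flip: Suc.IH)
  qed simp
  have "(\<lambda>N. (of_real (ln (real N)) - (\<Sum>n<N. inverse (1 - z + of_nat n)))
      - (of_real (ln (real N)) - (\<Sum>n<N. inverse (z + of_nat n))) + inverse (z + of_nat N))
    \<longlonglongrightarrow> Digamma (1 - z) - Digamma z + 0"
    by (intro tendsto_intros Digamma_LIMSEQ ne lim0)
  then show ?thesis by (simp add: Digamma_reflection assms flip: eq)
qed

lemma cot_partial_fractions_real: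
  fixes y :: real
  assumes "y \<notin> \<int>"
  shows "(\<lambda>N. \<Sum>k\<in>{- int N..int N}. inverse (y + of_int k)) \<longlonglongrightarrow> pi * cot (pi * y)"
proof -
  have "complex_of_real y \<notin> \<int>" using assms by simp
  from cot_partial_fractions [OF this]
  have "(\<lambda>N. complex_of_real (\<Sum>k\<in>{- int N..int N}. inverse (y + of_int k)))
      \<longlonglongrightarrow> complex_of_real (pi * cot (pi * y))"
    by (simp add: cot_of_real)
  then show ?thesis by (simp only: tendsto_of_real_iff)
qed

lemma cot_add_int_pi:
  fixes x :: real
  shows "cot (pi * (x + of_int k)) = cot (pi * x)"
proof -
  have "sin (pi * of_int k) = 0" "cos (pi * of_int k) \<noteq> 0"
    using sin_npi_int [of k] cos_npi_int [of k] by (auto simp: mult.commute)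
  then show ?thesis by (simp add: cot_def distrib_left sin_add cos_add)
qed

text \<open>The description in \<open>eisenstein_sum\<close> asks for one limit shared by all
  representatives of the coset. Periodicity of the cotangent provides it, and the single
  representative \<open>y\<close> already fixes its value.\<close>

lemma eisenstein_sum_unit_lattice:
  assumes "y \<notin> \<int>"
  shows "eisenstein_sum (range of_int) ((\<lambda>k. y + of_int k) ` UNIV) = pi * cot (pi * y)"
proof -
  have cov: "covolume (range of_int) = 1" using covolume_eq [of 1] by simp
  have lim: "(\<lambda>N. \<Sum>k\<in>{- int N..int N}. inverse (y + of_int j + of_int k)) \<longlonglongrightarrow> pi * cot (pi * y)" for j
  proof -
    have "y + of_int j \<notin> \<int>" using assms by (metis Ints_diff Ints_of_int add_diff_cancel)
    from cot_partial_fractions_real [OF this] show ?thesis by (simp add: cot_add_int_pi)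
  qed
  show ?thesis unfolding eisenstein_sum_def
  proof (rule the_equality)
    fix S assume "\<forall>x\<in>(\<lambda>k. y + of_int k) ` UNIV.
      (\<lambda>N. \<Sum>k\<in>{- int N..int N}. inverse (x + of_int k * covolume (range of_int))) \<longlonglongrightarrow> S"
    then have "(\<lambda>N. \<Sum>k\<in>{- int N..int N}. inverse (y + of_int 0 + of_int k)) \<longlonglongrightarrow> S"
      unfolding cov by fastforce
    with lim show "S = pi * cot (pi * y)" using LIMSEQ_unique by blast
  qed (use lim cov in auto)
qed

section \<open>The functions \<open>e\<^bsub>1,a\<^esub>\<close> in terms of the characters\<close>

lemma char_QZ_qz: "char_QZ (qz q) = exp (2 * of_real pi * \<i> * of_rat q)"
  by (rule char_QZ.abs_eq)

lemma char_QZ_add: "char_QZ (x + y) = char_QZ x * char_QZ y"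
  by transfer (simp add: of_rat_add distrib_left exp_add)

lemma char_QZ_0 [simp]: "char_QZ 0 = 1"
  by transfer simp

lemma of_real_of_rat: "complex_of_real (of_rat q) = of_rat q"
  by (cases q) (simp add: of_rat_rat)

lemma char_QZ_eq_1_iff: "char_QZ (qz q) = 1 \<longleftrightarrow> q \<in> \<int>"
proof -
  have "char_QZ (qz q) = 1 \<longleftrightarrow> (\<exists>n::int. of_rat q = real_of_int n)"
    by (simp add: char_QZ_qz exp_eq_1 flip: of_real_of_rat)
  also have "\<dots> \<longleftrightarrow> q \<in> \<int>"
    by (metis Ints_cases Ints_of_int of_rat_of_int_eq of_rat_eq_iff)
  finally show ?thesis .
qed

lemma e_fun_add: "e_fun (r + s) \<rho> = e_fun r \<rho> * e_fun s \<rho>"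
  by (simp add: e_fun_def app_add char_QZ_add)

lemma e_fun_0 [simp]: "e_fun 0 \<rho> = 1"
  using app_add [of \<rho> 0 0] by (simp add: e_fun_def)

text \<open>The exponent is a denominator of \<open>a\<close>, which every endomorphism respects. It
  is therefore uniform in the point of R, so that one polynomial can serve for all points.\<close>

lemma e_fun_root_of_unity:
  obtains N where "N > 0" "\<And>\<rho>. e_fun a \<rho> ^ N = 1"
proof -
  obtain q where q: "a = qz q" using qz_surj by blast
  obtain m n where mn: "q = of_int m / of_int n" "n > 0"
    by (metis Fract_of_int_quotient Rat_cases)
  have "e_fun a \<rho> ^ nat n = 1" for \<rho>
  proof -
    obtain k where "app \<rho> a = qz (of_int (m * k) / of_int n)"
      using app_cyclic [OF mn(2)] unfolding q mn(1) by metis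
    then have "e_fun a \<rho> ^ nat n
        = exp (of_nat (nat n) * (2 * of_real pi * \<i> * of_rat (of_int (m * k) / of_int n)))"
      by (simp add: e_fun_def char_QZ_qz exp_of_nat_mult)
    also have "of_nat (nat n) * (2 * of_real pi * \<i> * of_rat (of_int (m * k) / of_int n))
        = 2 * of_real pi * \<i> * of_rat (of_int (m * k))"
      using mn(2) by (simp add: of_rat_divide)
    also have "exp \<dots> = 1" using char_QZ_eq_1_iff [of "of_int (m * k)"] by (simp only: char_QZ_qz Ints_of_int)
    finally show ?thesis .
  qed
  with mn(2) that [of "nat n"] show ?thesis by simp
qed

text \<open>Euler's formulas. At integers both sides are 0 by the convention on division by 0, which
  is the case \<open>d = 0\<close> of \<open>frac\<close>.\<close>

lemma cot_pi_eq_exp: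
  fixes z :: complex
  shows "cot (of_real pi * z) = \<i> * (exp (2 * of_real pi * \<i> * z) + 1) / (exp (2 * of_real pi * \<i> * z) - 1)"
proof -
  define w where "w = exp (\<i> * (of_real pi * z))"
  have w: "w \<noteq> 0" "exp (- (\<i> * (of_real pi * z))) = inverse w" "exp (2 * of_real pi * \<i> * z) = w\<^sup>2"
    by (simp_all add: w_def exp_minus mult_ac flip: exp_double)
  have frac: "(p / 2) / (d / (2 * \<i>)) = \<i> * (p / d)" for p d :: complex
    by (cases "d = 0") (simp_all add: field_simps)
  have "cot (of_real pi * z) = \<i> * ((w + inverse w) / (w - inverse w))"
    unfolding cot_def cos_exp_eq sin_exp_eq w(2) w_def [symmetric] by (rule frac)
  also have "(w + inverse w) / (w - inverse w) = (w * (w + inverse w)) / (w * (w - inverse w))"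
    using w(1) by simp
  also have "\<dots> = (w\<^sup>2 + 1) / (w\<^sup>2 - 1)"
    using w(1) by (simp add: algebra_simps power2_eq_square)
  finally show ?thesis by (simp add: w)
qed

text \<open>If \<open>q\<close> represents the image of \<open>a\<close>, the coset is q + Z with
  Eisenstein sum pi cot(pi q); the factor 1/(2 pi i) cancels pi and the i of the exponential form.
  The coset is the lattice itself exactly when \<open>q\<close> is an integer, that is, when the
  character value is 1.\<close>

lemma e1_eq: "e1 a \<rho> = (if e_fun a \<rho> = 1 then 0 else (e_fun a \<rho> + 1) / (2 * (e_fun a \<rho> - 1)))"
proof -
  obtain q where q: "app \<rho> a = qz q" using qz_surj by blast
  have coset: "{of_rat q' | q'. qz q' = app \<rho> a} = range (\<lambda>k. of_rat q + real_of_int k)" (is "?A = ?B")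
  proof (intro equalityI subsetI)
    fix x assume "x \<in> ?A"
    then obtain q' where x: "x = of_rat q'" "q' - q \<in> \<int>" by (auto simp: q qz_eq_iff)
    then obtain k where "q' = q + of_int k" by (metis Ints_cases diff_add_cancel add.commute)
    then show "x \<in> ?B" by (auto simp: x of_rat_add)
  next
    fix x assume "x \<in> ?B"
    then obtain k :: int where "x = of_rat (q + of_int k)" by (auto simp: of_rat_add)
    then show "x \<in> ?A" unfolding q by (auto simp: qz_eq_iff intro!: exI [of _ "q + of_int k"])
  qed
  have int: "(of_rat q :: real) \<in> \<int> \<longleftrightarrow> q \<in> \<int>"
    by (metis Ints_cases Ints_of_int of_rat_of_int_eq of_rat_eq_iff)
  have zero: "?B = range real_of_int \<longleftrightarrow> q \<in> \<int>"
  proof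
    assume "?B = range real_of_int"
    moreover have "of_rat q + real_of_int 0 \<in> ?B" by blast
    ultimately have "of_rat q \<in> range real_of_int" by simp
    then show "q \<in> \<int>" unfolding int [symmetric] by (simp add: Ints_def)
  next
    assume "q \<in> \<int>"
    then obtain j where j: "q = of_int j" by (auto elim: Ints_cases)
    have "x \<in> ?B" if "x = real_of_int k" for x k
      by (rule range_eqI [of _ _ "k - j"]) (simp add: j that)
    moreover have "?B \<subseteq> range real_of_int" by (auto simp: j simp flip: of_int_add)
    ultimately show "?B = range real_of_int" by blast
  qed
  have z: "e_fun a \<rho> = 1 \<longleftrightarrow> q \<in> \<int>" by (simp add: e_fun_def q char_QZ_eq_1_iff)
  have e1: "e1 a \<rho> = (if q \<in> \<int> then 0 else
      1 / (2 * of_real pi * \<i>) * of_real (eisenstein_sum (range of_int) ?B))"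
    using covolume_eq [of 1] unfolding e1_def e1_lat_def Q_lattice_def by (simp add: coset zero c_lat_def)
  show ?thesis
  proof (cases "q \<in> \<int>")
    case False
    then have "of_real (eisenstein_sum (range of_int) ?B) = of_real pi * cot (of_real pi * of_real (of_rat q) :: complex)"
      by (simp add: eisenstein_sum_unit_lattice int cot_of_real)
    also have "\<dots> = of_real pi * (\<i> * (e_fun a \<rho> + 1) / (e_fun a \<rho> - 1))"
      by (simp add: cot_pi_eq_exp e_fun_def q char_QZ_qz of_real_of_rat)
    finally show ?thesis using False by (simp add: e1 z)
  qed (simp add: e1 z)
qed

text \<open>For z different from 1 the geometric sum vanishes and the sum of k z^k is N/(z - 1),
  which leaves 1/2 + 1/(z - 1). At z = 1 the coefficients add up to (N - 1)/2 - N/2 = -1/2, and the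
  constant 1/2 cancels this.\<close>

lemma e1_eq_polynomial:
  assumes N: "N > 0" "e_fun a \<rho> ^ N = 1"
  shows "e1 a \<rho> = 1/2 + (\<Sum>k<N. of_rat (of_nat k / of_nat N - 1/2) * e_fun a \<rho> ^ k)"
proof -
  define z where "z = e_fun a \<rho>"
  \<comment> \<open>Summation by parts.\<close>
  have arith: "(z - 1) * (\<Sum>k<n. of_nat k * z ^ k) = of_nat n * z ^ n - z * (\<Sum>k<n. z ^ k)" for n
    by (induction n) (simp_all add: algebra_simps)
  have split: "(\<Sum>k<N. of_rat (of_nat k / of_nat N - 1/2) * z ^ k)
      = (\<Sum>k<N. of_nat k * z ^ k) / of_nat N - (\<Sum>k<N. z ^ k) / 2"
    by (simp add: of_rat_diff of_rat_divide left_diff_distrib sum_subtractf sum_divide_distrib)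
  show ?thesis
  proof (cases "z = 1")
    case True
    have "2 * (\<Sum>k<N. of_nat k :: complex) = of_nat N * (of_nat N - 1)"
      by (induction N) (simp_all add: algebra_simps)
    then have "(\<Sum>k<N. of_nat k :: complex) = of_nat N * (of_nat N - 1) / 2"
      by (simp only: eq_divide_eq mult.commute) simp
    with True N show ?thesis
      unfolding e1_eq split [unfolded z_def] z_def by (simp add: field_simps)
  next
    case False
    have geom: "(\<Sum>k<N. z ^ k) = 0" using False N by (simp add: sum_gp_strict z_def)
    then have "(z - 1) * (\<Sum>k<N. of_nat k * z ^ k) = of_nat N"
      using arith [of N] N by (simp add: z_def)
    then have sum: "(\<Sum>k<N. of_nat k * z ^ k) = of_nat N / (z - 1)"
      using False by (simp add: eq_divide_eq mult.commute)
    have "e1 a \<rho> = (z + 1) / (2 * (z - 1))" using False by (simp add: e1_eq z_def)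
    also have "\<dots> = 1/2 + (of_nat N / (z - 1) / of_nat N - 0 / 2)"
      using False N by (simp add: field_simps)
    finally show ?thesis unfolding z_def [symmetric] split geom sum .
  qed
qed

section \<open>Recovering e(2b) from e_{1,b}\<close>

text \<open>In the binomial expansion the leading powers of \<open>u\<close> cancel, and every
  remaining term except the constant \<open>2 ^ Suc M\<close> is divisible by \<open>u\<close>.
  Dividing by that constant exhibits the inverse, so \<open>u\<close> is nonzero as well.\<close>

lemma inverse_eq_polynomial:
  fixes u :: complex
  assumes "(u + 2) ^ Suc M = u ^ Suc M"
  shows "inverse u = (\<Sum>k<M. of_rat (- of_nat (Suc M choose Suc k) / 2 ^ Suc k) * u ^ k)"
proof -
  have "(u + 2) ^ Suc M = (\<Sum>k\<le>Suc M. of_nat (Suc M choose k) * u ^ k * 2 ^ (Suc M - k))"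
    by (rule binomial_ring)
  also have "\<dots> = 2 ^ Suc M + (\<Sum>k<M. of_nat (Suc M choose Suc k) * u ^ Suc k * 2 ^ (M - k)) + u ^ Suc M"
    unfolding sum.atMost_Suc_shift by (simp add: lessThan_Suc_atMost [symmetric] del: binomial_Suc_Suc)
  finally have "2 ^ Suc M = - (\<Sum>k<M. of_nat (Suc M choose Suc k) * u ^ Suc k * 2 ^ (M - k))"
    unfolding assms by (simp add: eq_neg_iff_add_eq_0)
  also have "\<dots> = (\<Sum>k<M. 2 ^ Suc M * u * (of_rat (- of_nat (Suc M choose Suc k) / 2 ^ Suc k) * u ^ k))"
    unfolding sum_negf [symmetric]
  proof (rule sum.cong [OF refl])
    fix k assume "k \<in> {..<M}"
    then have "2 ^ Suc M = (2 ^ Suc k * 2 ^ (M - k) :: complex)" by (simp flip: power_add)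
    then show "- (of_nat (Suc M choose Suc k) * u ^ Suc k * 2 ^ (M - k))
        = 2 ^ Suc M * u * (of_rat (- of_nat (Suc M choose Suc k) / 2 ^ Suc k) * u ^ k)"
      by (simp add: of_rat_minus of_rat_divide of_rat_power of_rat_mult del: binomial_Suc_Suc)
  qed
  finally have "1 = u * (\<Sum>k<M. of_rat (- of_nat (Suc M choose Suc k) / 2 ^ Suc k) * u ^ k)"
    unfolding sum_distrib_left [symmetric] mult.assoc by simp
  then show ?thesis by (metis inverse_unique)
qed

text \<open>Away from z = 1 one has u = 2/(z - 1), so that 1 + 2/u = z and u + 2 = u z. At z = 1,
  where u = -1, the value of 1 + 2/u is -1 instead; the square, respectively the even exponent,
  removes this wrong sign.\<close>

lemma e_fun_double_eq_e1:
  fixes b \<rho>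
  defines "u \<equiv> 2 * e1 b \<rho> - 1"
  shows "e_fun (b + b) \<rho> = (1 + 2 * inverse u)\<^sup>2"
    and "\<lbrakk>even N; e_fun b \<rho> ^ N = 1\<rbrakk> \<Longrightarrow> (u + 2) ^ N = u ^ N"
proof -
  define z where "z = e_fun b \<rho>"
  have u: "u = - 1 \<and> z = 1 \<or> z \<noteq> 1 \<and> u = 2 / (z - 1)"
    unfolding u_def e1_eq z_def by (cases "e_fun b \<rho> = 1") (simp_all add: field_simps)
  then show "e_fun (b + b) \<rho> = (1 + 2 * inverse u)\<^sup>2"
    unfolding e_fun_add z_def [symmetric] by (auto simp: power2_eq_square diff_divide_distrib)
  show "(u + 2) ^ N = u ^ N" if "even N" "e_fun b \<rho> ^ N = 1"
  proof (cases "z = 1")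
    case True
    then show ?thesis using u that by simp
  next
    case False
    then have "u + 2 = u * z" using u by (simp add: field_simps)
    then show ?thesis using that by (simp add: power_mult_distrib z_def)
  qed
qed

section \<open>Generated subalgebras\<close>

lemma Q_subalgebra_polynomial:
  assumes B: "Q_subalgebra A (\<lambda>f g x. f x * g x) (\<lambda>x. 1) B" and f: "f \<in> B"
  shows "(\<lambda>x. \<Sum>k<n. of_rat (c k) * f x ^ k) \<in> B"
proof -
  have one: "(\<lambda>x. 1) \<in> B"
    and add: "\<And>f g. f \<in> B \<Longrightarrow> g \<in> B \<Longrightarrow> (\<lambda>x. f x + g x) \<in> B"
    and mul: "\<And>f g. f \<in> B \<Longrightarrow> g \<in> B \<Longrightarrow> (\<lambda>x. f x * g x) \<in> B"
    and scale: "\<And>q f. f \<in> B \<Longrightarrow> (\<lambda>x. of_rat q * f x) \<in> B"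
    using B unfolding Q_subalgebra_def by blast+
  have pow: "(\<lambda>x. f x ^ k) \<in> B" for k
    by (induction k) (simp_all add: one mul f)
  have zero: "(\<lambda>x. 0) \<in> B" using scale [OF one, of 0] by simp
  show ?thesis by (induction n) (simp_all add: zero add scale pow)
qed

section \<open>The rational group ring as a subalgebra of C(R)\<close>

text \<open>Sums and products of elements repeat exponents, whereas
  \<open>rational_group_ring\<close> has one coefficient per exponent; coefficients are collected
  along the fibres of \<open>g\<close>.\<close>

lemma rational_group_ringI:
  assumes "finite I"
  shows "(\<lambda>\<rho>. \<Sum>i\<in>I. of_rat (c i) * e_fun (g i) \<rho>) \<in> rational_group_ring"
proof -
  have "(\<Sum>i\<in>I. of_rat (c i) * e_fun (g i) \<rho>)
      = (\<Sum>r\<in>g ` I. of_rat (\<Sum>i\<in>{i\<in>I. g i = r}. c i) * e_fun r \<rho>)" for \<rho>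
    by (subst sum.image_gen [OF assms, of _ g]) (simp add: of_rat_sum sum_distrib_right)
  then show ?thesis using assms
    by (auto simp: rational_group_ring_def
        intro!: exI [of _ "g ` I"] exI [of _ "\<lambda>r. \<Sum>i\<in>{i\<in>I. g i = r}. c i"])
qed

lemma e_fun_in_rational_group_ring: "e_fun r \<in> rational_group_ring"
  using rational_group_ringI [of "{()}" "\<lambda>_. 1" "\<lambda>_. r"] by simp

text \<open>The function factors through the coordinate projection at \<open>r\<close> into the
  discrete space \<open>QZ\<close>, on which every map is continuous.\<close>

lemma continuous_e_fun: "continuous_on UNIV (e_fun r)"
  unfolding continuous_on_open_vimage [OF open_UNIV] Int_UNIV_right
proof (intro allI impI)
  fix U :: "complex set"
  have "open ((\<lambda>f :: QZ \<Rightarrow> QZ. f r) -` (char_QZ -` U))"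
    by (rule open_vimage) (auto simp: open_QZ_def intro: continuous_on_product_coordinates)
  moreover have "e_fun r -` U = app -` ((\<lambda>f. f r) -` (char_QZ -` U))"
    by (auto simp: e_fun_def)
  ultimately show "open (e_fun r -` U)" unfolding open_Zhat_def by blast
qed

lemma Q_subalgebra_rational_group_ring:
  "Q_subalgebra C_R (\<lambda>f g \<rho>. f \<rho> * g \<rho>) (\<lambda>\<rho>. 1) rational_group_ring"
  unfolding Q_subalgebra_def
proof (intro conjI ballI allI)
  show "rational_group_ring \<subseteq> C_R"
    by (auto simp: rational_group_ring_def C_R_def intro!: continuous_intros
        continuous_on_subset [OF continuous_e_fun])
  show "(\<lambda>\<rho>. 1) \<in> rational_group_ring"
    using e_fun_in_rational_group_ring [of 0] by (simp add: e_fun_0 [abs_def])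
next
  fix f g assume "f \<in> rational_group_ring" "g \<in> rational_group_ring"
  then obtain S c T d where S: "finite S" "f = (\<lambda>\<rho>. \<Sum>r\<in>S. of_rat (c r) * e_fun r \<rho>)"
    and T: "finite T" "g = (\<lambda>\<rho>. \<Sum>r\<in>T. of_rat (d r) * e_fun r \<rho>)"
    unfolding rational_group_ring_def by blast
  \<comment> \<open>A disjoint sum of index sets allows \<open>S\<close> and \<open>T\<close> to
    overlap.\<close>
  have "(\<lambda>\<rho>. f \<rho> + g \<rho>)
      = (\<lambda>\<rho>. \<Sum>i\<in>S <+> T. of_rat (case_sum c d i) * e_fun (case_sum id id i) \<rho>)"
    using S T by (simp add: sum.Plus)
  then show "(\<lambda>\<rho>. f \<rho> + g \<rho>) \<in> rational_group_ring"
    using S T by (simp only:) (rule rational_group_ringI, simp)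
  have "(\<lambda>\<rho>. f \<rho> * g \<rho>)
      = (\<lambda>\<rho>. \<Sum>i\<in>S \<times> T. of_rat (c (fst i) * d (snd i)) * e_fun (fst i + snd i) \<rho>)"
    using S T by (simp add: sum_product sum.cartesian_product' of_rat_mult e_fun_add mult_ac)
  then show "(\<lambda>\<rho>. f \<rho> * g \<rho>) \<in> rational_group_ring"
    using S T by (simp only:) (rule rational_group_ringI, simp)
next
  fix q f assume "f \<in> rational_group_ring"
  then obtain S c where S: "finite S" "f = (\<lambda>\<rho>. \<Sum>r\<in>S. of_rat (c r) * e_fun r \<rho>)"
    unfolding rational_group_ring_def by blast
  then have "(\<lambda>\<rho>. of_rat q * f \<rho>) = (\<lambda>\<rho>. \<Sum>r\<in>S. of_rat (q * c r) * e_fun r \<rho>)"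
    by (simp add: sum_distrib_left of_rat_mult mult.assoc)
  then show "(\<lambda>\<rho>. of_rat q * f \<rho>) \<in> rational_group_ring"
    using rational_group_ringI [OF S(1), of "\<lambda>r. q * c r" "\<lambda>r. r"] by simp
qed

lemma rational_group_ring_subset:
  assumes B: "Q_subalgebra A (\<lambda>f g \<rho>. f \<rho> * g \<rho>) (\<lambda>\<rho>. 1) B" and e: "range e_fun \<subseteq> B"
  shows "rational_group_ring \<subseteq> B"
proof
  fix f assume "f \<in> rational_group_ring"
  then obtain S c where S: "finite S" "f = (\<lambda>\<rho>. \<Sum>r\<in>S. of_rat (c r) * e_fun r \<rho>)"
    unfolding rational_group_ring_def by blast
  have one: "(\<lambda>\<rho>. 1) \<in> B"
    and add: "\<And>f g. f \<in> B \<Longrightarrow> g \<in> B \<Longrightarrow> (\<lambda>x. f x + g x) \<in> B"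
    and scale: "\<And>q f. f \<in> B \<Longrightarrow> (\<lambda>x. of_rat q * f x) \<in> B"
    using B unfolding Q_subalgebra_def by blast+
  have zero: "(\<lambda>x. 0) \<in> B" using scale [OF one, of 0] by simp
  have "(\<lambda>\<rho>. \<Sum>r\<in>S. of_rat (c r) * e_fun r \<rho>) \<in> B"
    using S(1) by induction (use e in \<open>auto intro!: zero add scale\<close>)
  then show "f \<in> B" by (simp add: S)
qed

lemma e1_in_rational_group_ring: "e1 a \<in> rational_group_ring"
proof -
  note B = Q_subalgebra_rational_group_ring
  have add: "\<And>f g. f \<in> rational_group_ring \<Longrightarrow> g \<in> rational_group_ring \<Longrightarrow> (\<lambda>\<rho>. f \<rho> + g \<rho>) \<in> rational_group_ring"
    using B unfolding Q_subalgebra_def by blast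
  obtain N where N: "N > 0" "\<And>\<rho>. e_fun a \<rho> ^ N = 1" using e_fun_root_of_unity by blast
  have half: "(\<lambda>\<rho>. 1/2) \<in> rational_group_ring"
    using rational_group_ringI [of "{()}" "\<lambda>_. 1/2" "\<lambda>_. 0"] by (simp add: of_rat_divide)
  have "e1 a = (\<lambda>\<rho>. 1/2 + (\<Sum>k<N. of_rat (of_nat k / of_nat N - 1/2) * e_fun a \<rho> ^ k))"
    by (rule ext) (rule e1_eq_polynomial [OF N])
  also have "\<dots> \<in> rational_group_ring"
    by (rule add [OF half Q_subalgebra_polynomial [OF B e_fun_in_rational_group_ring]])
  finally show ?thesis .
qed

lemma QZ_divisible_2: "\<exists>b :: QZ. r = b + b"
proof -
  obtain q where "r = qz q" using qz_surj by blast
  then have "r = qz (q / 2) + qz (q / 2)" by (simp add: plus_QZ.abs_eq)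
  then show ?thesis by blast
qed

lemma e_fun_in_subalgebra:
  assumes B: "Q_subalgebra A (\<lambda>f g \<rho>. f \<rho> * g \<rho>) (\<lambda>\<rho>. 1) B" and e1: "range e1 \<subseteq> B"
  shows "e_fun r \<in> B"
proof -
  obtain b where r: "r = b + b" using QZ_divisible_2 by blast
  obtain N where N: "N > 0" "\<And>\<rho>. e_fun b \<rho> ^ N = 1" using e_fun_root_of_unity by blast
  \<comment> \<open>Doubling \<open>N\<close> makes the exponent even; the form \<open>Suc M\<close>
    is the one used by \<open>inverse_eq_polynomial\<close>.\<close>
  then obtain M where M: "2 * N = Suc M" by (metis gr0_implies_Suc nat_0_less_mult_iff zero_less_numeral)
  define u where "u \<rho> = 2 * e1 b \<rho> - 1" for \<rho>
  have poly: "(\<lambda>\<rho>. \<Sum>k<n. of_rat (c k) * f \<rho> ^ k) \<in> B" if "f \<in> B" for f n and c :: "nat \<Rightarrow> rat"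
    by (rule Q_subalgebra_polynomial [OF B that])
  have u: "u = (\<lambda>\<rho>. \<Sum>k<2. of_rat (if k = 0 then -1 else 2) * e1 b \<rho> ^ k)"
    by (simp add: u_def fun_eq_iff numeral_2_eq_2)
  have "u \<in> B" unfolding u by (rule poly) (use e1 in auto)
  have "(u \<rho> + 2) ^ Suc M = u \<rho> ^ Suc M" for \<rho>
    unfolding u_def M [symmetric] by (rule e_fun_double_eq_e1(2)) (simp_all add: power_mult N mult.commute [of 2])
  then have "(\<lambda>\<rho>. inverse (u \<rho>)) = (\<lambda>\<rho>. \<Sum>k<M. of_rat (- of_nat (Suc M choose Suc k) / 2 ^ Suc k) * u \<rho> ^ k)"
    by (intro ext inverse_eq_polynomial)
  also have "\<dots> \<in> B" by (rule poly [OF \<open>u \<in> B\<close>])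
  finally have inv: "(\<lambda>\<rho>. inverse (u \<rho>)) \<in> B" .
  \<comment> \<open>The list holds the coefficients of (1 + 2x)^2, with x the inverse of
    \<open>u\<close>.\<close>
  have "e_fun r = (\<lambda>\<rho>. \<Sum>k<3. of_rat ([1, 4, 4] ! k) * inverse (u \<rho>) ^ k)"
    by (simp add: fun_eq_iff r e_fun_double_eq_e1(1) u_def numeral_3_eq_3 power2_eq_square algebra_simps)
  also have "\<dots> \<in> B" by (rule poly [OF inv])
  finally show ?thesis .
qed

lemma Q_generated_e1: "Q_generated_C_R (range e1) = rational_group_ring"
  (is "?G = _")
proof
  have "range e1 \<subseteq> rational_group_ring" using e1_in_rational_group_ring by blast
  then show "?G \<subseteq> rational_group_ring"
    unfolding Q_generated_def using Q_subalgebra_rational_group_ring by blast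
  show "rational_group_ring \<subseteq> ?G"
    unfolding Q_generated_def using rational_group_ring_subset e_fun_in_subalgebra by blast
qed

section \<open>Transfer to the convolution algebra\<close>

lemma is_rscale_one: "is_rscale 1 \<rho> \<rho>"
  by (simp add: is_rscale_def)

text \<open>The second factor is supported on the units, so only \<open>s = 1\<close> contributes to
  the series; the first factor then forces \<open>r = 1\<close>.\<close>

lemma conv_incl: "conv (incl f) (incl g) = incl (\<lambda>\<rho>. f \<rho> * g \<rho>)"
proof (rule ext, clarify)
  fix r \<rho>
  have in1: "(1, \<rho>) \<in> Grpd" unfolding Grpd_def using is_rscale_one by auto
  have "(\<Sum>\<^sub>\<infinity>s\<in>Grpd_from \<rho>. incl f (r / s, rscale s \<rho>) * incl g (s, \<rho>))
      = (\<Sum>\<^sub>\<infinity>s\<in>{1}. incl f (r / s, rscale s \<rho>) * incl g (s, \<rho>))"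
    using in1 by (intro infsum_cong_neutral) (auto simp: incl_def Grpd_from_def)
  also have "\<dots> = incl (\<lambda>\<rho>. f \<rho> * g \<rho>) (r, \<rho>)"
    by (simp add: incl_def rscale_eq [OF is_rscale_one])
  finally show "conv (incl f) (incl g) (r, \<rho>) = incl (\<lambda>\<rho>. f \<rho> * g \<rho>) (r, \<rho>)"
    using in1 by (auto simp: conv_def incl_def)
qed

text \<open>Because \<open>incl\<close> is unital, linear and multiplicative, results on subalgebras
  of C(R) become available inside any convolution subalgebra.\<close>

lemma Q_subalgebra_incl_preimage:
  assumes "Q_subalgebra A conv (incl (\<lambda>\<rho>. 1)) B"
  shows "Q_subalgebra C_R (\<lambda>f g \<rho>. f \<rho> * g \<rho>) (\<lambda>\<rho>. 1) {f \<in> C_R. incl f \<in> B}"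
proof -
  have "incl (\<lambda>\<rho>. f \<rho> + g \<rho>) = (\<lambda>x. incl f x + incl g x)"
    and "incl (\<lambda>\<rho>. of_rat q * f \<rho>) = (\<lambda>x. of_rat q * incl f x)" for f g q
    by (auto simp: incl_def)
  then show ?thesis
    using assms unfolding Q_subalgebra_def
    by (auto simp: C_R_def intro!: continuous_intros simp flip: conv_incl)
qed

text \<open>Generated algebras are intersections, so they agree once every subalgebra contains both
  families or neither. This is the pointwise statement applied to the preimage
  \<open>B'\<close>.\<close>

lemma incl_e1_subset_iff:
  assumes "Q_subalgebra A conv (incl (\<lambda>\<rho>. 1)) B"
  shows "range (\<lambda>a. incl (e1 a)) \<subseteq> B \<longleftrightarrow> range (\<lambda>r. incl (e_fun r)) \<subseteq> B"
proof -
  define B' where "B' = {f \<in> C_R. incl f \<in> B}"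
  have B': "Q_subalgebra C_R (\<lambda>f g \<rho>. f \<rho> * g \<rho>) (\<lambda>\<rho>. 1) B'"
    unfolding B'_def by (rule Q_subalgebra_incl_preimage [OF assms])
  have "e1 a \<in> C_R" "e_fun a \<in> C_R" for a
    using e1_in_rational_group_ring e_fun_in_rational_group_ring Q_subalgebra_rational_group_ring
    unfolding Q_subalgebra_def by blast+
  then have "range (\<lambda>a. incl (e1 a)) \<subseteq> B \<longleftrightarrow> range e1 \<subseteq> B'"
    and "range (\<lambda>r. incl (e_fun r)) \<subseteq> B \<longleftrightarrow> range e_fun \<subseteq> B'"
    unfolding B'_def by auto
  moreover have "range e1 \<subseteq> B' \<longleftrightarrow> range e_fun \<subseteq> B'"
    using rational_group_ring_subset [OF B'] e_fun_in_subalgebra [OF B'] e1_in_rational_group_ring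
    by blast
  ultimately show ?thesis by simp
qed

theorem theorem1p13:
  shows "Q_generated_C_R (range e1) = rational_group_ring \<and>
    A_Q = Q_generated_Cstar_G
      (range (\<lambda>a. incl (e1 a)) \<union> {mu n | n. n \<ge> 1} \<union> {adj (mu n) | n. n \<ge> 1})"
proof (rule conjI [OF Q_generated_e1])
  show "A_Q = Q_generated_Cstar_G
      (range (\<lambda>a. incl (e1 a)) \<union> {mu n | n. n \<ge> 1} \<union> {adj (mu n) | n. n \<ge> 1})"
    \<comment> \<open>The generating sets share the \<open>mu\<close> and \<open>adj\<close> blocks;
      \<open>conj_cong\<close> makes the subalgebra property of \<open>B\<close> available when the
      remaining block is rewritten.\<close>
    unfolding A_Q_def Q_generated_def by (simp add: incl_e1_subset_iff cong: conj_cong)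
qed

end
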